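(* Let $(M,H)$, $(M',H')$ and $(M'',H'')$ be Carnot manifolds of step $r$, and let $\phi:M\to M'$ and $\psi:M'\to M''$ be Carnot manifold maps. Then, for all $a\in M$, the Carnot differentials satisfy $$\widehat{(\psi\circ\phi)}'(a)=\hat\psi'(\phi(a))\circ\hat\phi'(a).$$
   Context: All manifolds, bundles, vector fields and maps are smooth. A Carnot manifold of step $r$ is a pair $(M,H)$, where $M$ is a manifold and $H=(H_1,\ldots,H_r)$ is a filtration of vector subbundles $H_1\subset H_2\subset\cdots\subset H_r=TM$ such that $[X,Y]$ is a section of $H_{w+w'}$ whenever $X$ is a section of $H_w$, $Y$ is a section of $H_{w'}$ and $w+w'\le r$. A Carnot manifold map between step $r$ Carnot manifolds $(M,H)$ and $(M',H')$ is a smooth map $\phi:M\to M'$ such that $\phi'(x)(H_j(x))\subset H'_j(\phi(x))$ for all $x\in M$ and $j=1,\ldots,r$, where $\phi'(x)$ is the usual differential. Set $H_0=\{0\}$, $\mathfrak g_wM=H_w/H_{w-1}$ and $\mathfrak gM=\mathfrak g_1M\oplus\cdots\oplus\mathfrak g_rM$. As a manifold the tangent group bundle $GM$ is $\mathfrak gM$. Carnot differential: for a Carnot manifold map $\phi:M\to M'$ and $a\in M$, $\phi'(a)$ maps $H_w(a)$ into $H'_w(\phi(a))$ for every $w$, hence induces linear maps $\hat\phi'_{[w]}(a):\mathfrak g_wM(a)\to\mathfrak g_wM'(\phi(a))$. The Carnot differential of $\phi$ at $a$ is $\hat\phi'(a)=\hat\phi'_{[1]}(a)\oplus\cdots\oplus\hat\phi'_{[r]}(a):\mathfrak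 gM(a)\to\mathfrak gM'(\phi(a))$. *)

theory Defs
  imports "HOL-Analysis.Analysis" "HOL-Library.Function_Algebras" "HOL-Library.Set_Algebras"
begin

text \<open>
  Tangent vectors are functionals on spaces of real functions, so we let real-valued functions
  (and functionals on them) carry their pointwise real vector space structure.
\<close>

instantiation "fun" :: (type, scaleR) scaleR
begin

definition scaleR_fun :: "real \<Rightarrow> ('a \<Rightarrow> 'b) \<Rightarrow> 'a \<Rightarrow> 'b" where
  "scaleR_fun c f = (\<lambda>x. c *\<^sub>R f x)"

instance ..

end

instance "fun" :: (type, real_vector) real_vector
  by standard (auto simp: scaleR_fun_def fun_eq_iff scaleR_add_right scaleR_add_left)

section \<open>Smooth functions on open subsets of Euclidean space\<close>

text \<open>
  The library's \<^const>\<open>Euclidean_space\<close> models the space of real n-tuples, for n a natural number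
  (possibly 0), as the sequences that vanish from index n on.
\<close>

definition partial_deriv :: "nat \<Rightarrow> ((nat \<Rightarrow> real) \<Rightarrow> real) \<Rightarrow> (nat \<Rightarrow> real) \<Rightarrow> real" where
  "partial_deriv i f x = deriv (\<lambda>t. f (x(i := t))) (x i)"

fun Ck_on :: "nat \<Rightarrow> nat \<Rightarrow> (nat \<Rightarrow> real) set \<Rightarrow> ((nat \<Rightarrow> real) \<Rightarrow> real) \<Rightarrow> bool" where
  "Ck_on n 0 S f \<longleftrightarrow> continuous_map (subtopology (Euclidean_space n) S) euclideanreal f"
| "Ck_on n (Suc k) S f \<longleftrightarrow>
     continuous_map (subtopology (Euclidean_space n) S) euclideanreal f \<and>
     (\<forall>i<n. (\<forall>x\<in>S. (\<lambda>t. f (x(i := t))) field_differentiable at (x i)) \<and>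
            Ck_on n k S (partial_deriv i f))"

definition Cinf_on :: "nat \<Rightarrow> (nat \<Rightarrow> real) set \<Rightarrow> ((nat \<Rightarrow> real) \<Rightarrow> real) \<Rightarrow> bool" where
  "Cinf_on n S f \<longleftrightarrow> (\<forall>k. Ck_on n k S f)"

section \<open>Smooth manifolds and smooth maps\<close>

text \<open>
  A chart is a pair of its domain and its coordinate map.  The atlas need not be maximal; none of
  the notions below changes when it is enlarged by compatible charts.
\<close>

record 'a manifold =
  mtop :: "'a topology"
  mdim :: nat
  atlas :: "('a set \<times> ('a \<Rightarrow> nat \<Rightarrow> real)) set"

abbreviation points :: "'a manifold \<Rightarrow> 'a set" where
  "points M \<equiv> topspace (mtop M)"

definition smooth_manifold :: "'a manifold \<Rightarrow> bool" where
  "smooth_manifold M \<longleftrightarrow>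
     Hausdorff_space (mtop M) \<and> second_countable (mtop M) \<and>
     (\<Union>(U, c)\<in>atlas M. U) = points M \<and>
     (\<forall>(U, c)\<in>atlas M.
        openin (mtop M) U \<and> openin (Euclidean_space (mdim M)) (c ` U) \<and>
        homeomorphic_map (subtopology (mtop M) U) (subtopology (Euclidean_space (mdim M)) (c ` U)) c) \<and>
     (\<forall>(U, c)\<in>atlas M. \<forall>(V, d)\<in>atlas M. \<forall>i<mdim M.
        Cinf_on (mdim M) (c ` (U \<inter> V)) (\<lambda>y. d (inv_into U c y) i))"

definition smooth_on :: "'a manifold \<Rightarrow> 'a set \<Rightarrow> ('a \<Rightarrow> real) \<Rightarrow> bool" where
  "smooth_on M W f \<longleftrightarrow>
     (\<forall>(U, c)\<in>atlas M. Cinf_on (mdim M) (c ` (U \<inter> W)) (\<lambda>y. f (inv_into U c y)))"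

definition smooth_map :: "'a manifold \<Rightarrow> 'b manifold \<Rightarrow> ('a \<Rightarrow> 'b) \<Rightarrow> bool" where
  "smooth_map M N \<phi> \<longleftrightarrow>
     continuous_map (mtop M) (mtop N) \<phi> \<and>
     (\<forall>(U, c)\<in>atlas M. \<forall>(V, d)\<in>atlas N. \<forall>i<mdim N.
        Cinf_on (mdim M) (c ` (U \<inter> \<phi> -` V)) (\<lambda>y. d (\<phi> (inv_into U c y)) i))"

section \<open>Tangent spaces and differentials\<close>

text \<open>
  The points of a manifold may form a proper subset of the ambient type.  Smooth functions are
  extended by 0 off the manifold and derivations by 0 off the smooth functions, so that the values
  outside the intended domains carry no information.
\<close>

definition restrict0 :: "'a set \<Rightarrow> ('a \<Rightarrow> 'b::zero) \<Rightarrow> 'a \<Rightarrow> 'b" where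
  "restrict0 A f = (\<lambda>x. if x \<in> A then f x else 0)"

definition Cinf :: "'a manifold \<Rightarrow> ('a \<Rightarrow> real) set" where
  "Cinf M = {f. smooth_on M (points M) f \<and> (\<forall>x. x \<notin> points M \<longrightarrow> f x = 0)}"

type_synonym 'a tvec = "('a \<Rightarrow> real) \<Rightarrow> real"

text \<open>The tangent space is the space of derivations at the point; \<open>f * g\<close> is the pointwise product.\<close>

definition tangent_space :: "'a manifold \<Rightarrow> 'a \<Rightarrow> 'a tvec set" where
  "tangent_space M p =
     {v. (\<forall>f. f \<notin> Cinf M \<longrightarrow> v f = 0) \<and>
         (\<forall>f\<in>Cinf M. \<forall>g\<in>Cinf M. v (f + g) = v f + v g) \<and>
         (\<forall>a. \<forall>f\<in>Cinf M. v (a *\<^sub>R f) = a * v f) \<and>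
         (\<forall>f\<in>Cinf M. \<forall>g\<in>Cinf M. v (f * g) = f p * v g + g p * v f)}"

text \<open>
  The differential of \<open>\<phi>\<close> at \<open>p\<close> sends \<open>v\<close> to the derivation \<open>g \<mapsto> v (g \<circ> \<phi>)\<close> at \<open>\<phi> p\<close>.  The base point
  is not an argument because a derivation on global functions determines the point it sits at,
  except for the zero vector, which is always sent to zero.
\<close>

definition differential :: "'a manifold \<Rightarrow> 'b manifold \<Rightarrow> ('a \<Rightarrow> 'b) \<Rightarrow> 'a tvec \<Rightarrow> 'b tvec" where
  "differential M N \<phi> v = restrict0 (Cinf N) (\<lambda>g. v (restrict0 (points M) (g \<circ> \<phi>)))"

section \<open>Vector fields and subbundles of the tangent bundle\<close>

definition smooth_vector_field_on :: "'a manifold \<Rightarrow> 'a set \<Rightarrow> ('a \<Rightarrow> 'a tvec) \<Rightarrow> bool" where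
  "smooth_vector_field_on M W X \<longleftrightarrow>
     (\<forall>p\<in>W. X p \<in> tangent_space M p) \<and> (\<forall>f\<in>Cinf M. smooth_on M W (\<lambda>p. X p f))"

definition lie_bracket :: "'a manifold \<Rightarrow> ('a \<Rightarrow> 'a tvec) \<Rightarrow> ('a \<Rightarrow> 'a tvec) \<Rightarrow> 'a \<Rightarrow> 'a tvec" where
  "lie_bracket M X Y p =
     (\<lambda>f. X p (restrict0 (points M) (\<lambda>q. Y q f)) - Y p (restrict0 (points M) (\<lambda>q. X q f)))"

text \<open>
  A subbundle is a family of fibres with a smooth local frame near every point; the rank
  \<open>k\<close> is thus locally constant.
\<close>

definition vector_subbundle :: "'a manifold \<Rightarrow> ('a \<Rightarrow> 'a tvec set) \<Rightarrow> bool" where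
  "vector_subbundle M E \<longleftrightarrow>
     (\<forall>p\<in>points M. \<exists>U (k::nat) X. openin (mtop M) U \<and> p \<in> U \<and>
        (\<forall>i<k. smooth_vector_field_on M U (X i)) \<and>
        (\<forall>q\<in>U. inj_on (\<lambda>i. X i q) {..<k} \<and> independent ((\<lambda>i. X i q) ` {..<k}) \<and>
               span ((\<lambda>i. X i q) ` {..<k}) = E q))"

definition smooth_section :: "'a manifold \<Rightarrow> ('a \<Rightarrow> 'a tvec set) \<Rightarrow> ('a \<Rightarrow> 'a tvec) \<Rightarrow> bool" where
  "smooth_section M E X \<longleftrightarrow> smooth_vector_field_on M (points M) X \<and> (\<forall>p\<in>points M. X p \<in> E p)"

section \<open>Carnot manifolds\<close>

text \<open>
  \<open>H w p\<close> is the fibre over \<open>p\<close> of the \<open>w\<close>-th bundle of the filtration.  The index 0 is used for the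
  convention that the filtration starts at the zero bundle; indices beyond \<open>r\<close> are irrelevant.
\<close>

definition carnot_manifold :: "nat \<Rightarrow> 'a manifold \<Rightarrow> (nat \<Rightarrow> 'a \<Rightarrow> 'a tvec set) \<Rightarrow> bool" where
  "carnot_manifold r M H \<longleftrightarrow>
     1 \<le> r \<and> smooth_manifold M \<and>
     (\<forall>w\<in>{1..r}. vector_subbundle M (H w)) \<and>
     (\<forall>p\<in>points M. H 0 p = {0}) \<and>
     (\<forall>w\<in>{1..<r}. \<forall>p\<in>points M. H w p \<subseteq> H (Suc w) p) \<and>
     (\<forall>p\<in>points M. H r p = tangent_space M p) \<and>
     (\<forall>w\<ge>1. \<forall>w'\<ge>1. w + w' \<le> r \<longrightarrow>
        (\<forall>X Y. smooth_section M (H w) X \<longrightarrow> smooth_section M (H w') Y \<longrightarrow>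
               smooth_section M (H (w + w')) (lie_bracket M X Y)))"

definition carnot_map ::
    "nat \<Rightarrow> 'a manifold \<Rightarrow> (nat \<Rightarrow> 'a \<Rightarrow> 'a tvec set) \<Rightarrow>
     'b manifold \<Rightarrow> (nat \<Rightarrow> 'b \<Rightarrow> 'b tvec set) \<Rightarrow> ('a \<Rightarrow> 'b) \<Rightarrow> bool" where
  "carnot_map r M H M' H' \<phi> \<longleftrightarrow>
     smooth_map M M' \<phi> \<and>
     (\<forall>x\<in>points M. \<forall>j\<in>{1..r}. differential M M' \<phi> ` H j x \<subseteq> H' j (\<phi> x))"

section \<open>The graded tangent spaces and the Carnot differential\<close>

text \<open>Elements of the quotient \<open>H w a / H (w - 1) a\<close> are cosets.\<close>

definition graded_piece :: "(nat \<Rightarrow> 'a \<Rightarrow> 'a tvec set) \<Rightarrow> nat \<Rightarrow> 'a \<Rightarrow> 'a tvec set set" where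
  "graded_piece H w a = (\<lambda>v. v +o H (w - 1) a) ` H w a"

text \<open>Elements of the finite direct sum are families indexed by \<open>{1..r}\<close>.\<close>

definition graded_tangent :: "nat \<Rightarrow> (nat \<Rightarrow> 'a \<Rightarrow> 'a tvec set) \<Rightarrow> 'a \<Rightarrow> (nat \<Rightarrow> 'a tvec set) set" where
  "graded_tangent r H a = (\<Pi>\<^sub>E w\<in>{1..r}. graded_piece H w a)"

text \<open>
  The map induced on quotients sends a coset to the common coset, modulo \<open>H' (w - 1) (\<phi> a)\<close>, of the
  images of its representatives.
\<close>

definition carnot_differential_piece ::
    "'a manifold \<Rightarrow> 'b manifold \<Rightarrow> (nat \<Rightarrow> 'b \<Rightarrow> 'b tvec set) \<Rightarrow>
     ('a \<Rightarrow> 'b) \<Rightarrow> nat \<Rightarrow> 'a \<Rightarrow> 'a tvec set \<Rightarrow> 'b tvec set" where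
  "carnot_differential_piece M M' H' \<phi> w a C =
     the_elem ((\<lambda>v. differential M M' \<phi> v +o H' (w - 1) (\<phi> a)) ` C)"

definition carnot_differential ::
    "nat \<Rightarrow> 'a manifold \<Rightarrow> (nat \<Rightarrow> 'a \<Rightarrow> 'a tvec set) \<Rightarrow>
     'b manifold \<Rightarrow> (nat \<Rightarrow> 'b \<Rightarrow> 'b tvec set) \<Rightarrow> ('a \<Rightarrow> 'b) \<Rightarrow>
     'a \<Rightarrow> (nat \<Rightarrow> 'a tvec set) \<Rightarrow> nat \<Rightarrow> 'b tvec set" where
  "carnot_differential r M H M' H' \<phi> a =
     (\<lambda>\<xi>\<in>graded_tangent r H a. \<lambda>w\<in>{1..r}. carnot_differential_piece M M' H' \<phi> w a (\<xi> w))"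

end

theory Submission
  imports Defs
begin

text \<open>
  Pulling a smooth function back along a smooth map gives a smooth function, by the chain rule in
  charts; as tangent vectors are functionals on smooth functions, the differential is therefore
  functorial.  It is also additive, so a Carnot manifold map acts on the cosets of \<open>H\<^sub>w\<^sub>-\<^sub>1\<close> in \<open>H\<^sub>w\<close>
  through arbitrary representatives, and functoriality descends to the graded pieces.
\<close>

section \<open>Open subsets of Euclidean space\<close>

text \<open>The topology is inherited from the product topology, whose basic neighbourhoods
  constrain each coordinate separately. Coordinates from \<open>n\<close> on are fixed at 0, so only
  \<open>n\<close> radii matter and a single one serves them all.\<close>

lemma openin_Euclidean_space_box:
  assumes "openin (Euclidean_space n) S" and "p \<in> S"
  obtains e where "e > 0"
    "\<And>q. \<lbrakk>\<And>j. j < n \<Longrightarrow> \<bar>q j - p j\<bar> < e; \<And>j. n \<le> j \<Longrightarrow> q j = 0\<rbrakk> \<Longrightarrow> q \<in> S"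
proof -
  obtain V where V: "openin (powertop_real UNIV) V" and S: "S = V \<inter> {x. \<forall>i\<ge>n. x i = 0}"
    using assms(1) by (auto simp: Euclidean_space_def openin_subtopology)
  have p0: "p j = 0" if "n \<le> j" for j
    using assms(2) S that by auto
  have "p \<in> V"
    using assms(2) S by auto
  then obtain X where X: "p \<in> (\<Pi>\<^sub>E i\<in>UNIV. X i)" "\<And>i. open (X i)" "(\<Pi>\<^sub>E i\<in>UNIV. X i) \<subseteq> V"
    using product_topology_open_contains_basis[OF V] by (metis open_openin)
  \<comment> \<open>Every small enough radius suits a given coordinate; the filter
    \<open>at_right 0\<close> merges the \<open>n\<close> conditions and also covers
    \<open>n = 0\<close>.\<close>
  have "\<forall>\<^sub>F e in at_right 0. e > 0 \<and> (\<forall>j<n. ball (p j) e \<subseteq> X j)"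
  proof -
    have "\<forall>\<^sub>F e in at_right 0. ball (p j) e \<subseteq> X j" for j
    proof -
      obtain d where "d > 0" "ball (p j) d \<subseteq> X j"
        using X(1) X(2)[of j] by (auto simp: PiE_iff elim: openE)
      then show ?thesis
        unfolding eventually_at_right_field by (meson order.trans subset_ball less_imp_le)
    qed
    then have "\<forall>\<^sub>F e in at_right 0. \<forall>j\<in>{..<n}. ball (p j) e \<subseteq> X j"
      by (intro eventually_ball_finite) auto
    then show ?thesis
      using eventually_at_right_less[of "0::real"] by eventually_elim auto
  qed
  then obtain e where e: "e > 0" "\<And>j. j < n \<Longrightarrow> ball (p j) e \<subseteq> X j"
    by (auto dest!: eventually_happens)
  show thesis
  proof (rule that[OF e(1)])
    fix q assume q: "\<And>j. j < n \<Longrightarrow> \<bar>q j - p j\<bar> < e" "\<And>j. n \<le> j \<Longrightarrow> q j = 0"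
    have "q j \<in> X j" for j
    proof (cases "j < n")
      case True
      then show ?thesis
        using q(1)[OF True] e(2)[OF True] by (auto simp: dist_real_def subset_iff)
    next
      case False
      then have "q j = p j"
        by (simp add: q(2) p0)
      then show ?thesis
        using X(1) by (auto simp: PiE_iff)
    qed
    then show "q \<in> S"
      using X(3) q(2) by (auto simp: S PiE_iff subset_iff)
  qed
qed

text \<open>This makes the one-variable functions behind \<open>partial_deriv\<close> depend, near
  \<open>x i\<close>, only on values taken in \<open>S\<close>. The bound \<open>i < n\<close> keeps
  \<open>x(i := t)\<close> inside the Euclidean space.\<close>

lemma eventually_fun_upd_in_openin:
  assumes "openin (Euclidean_space n) S" and "x \<in> S" and "i < n"
  shows "\<forall>\<^sub>F t in nhds (x i). x(i := t) \<in> S"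
proof -
  obtain e where e: "e > 0"
    "\<And>q. \<lbrakk>\<And>j. j < n \<Longrightarrow> \<bar>q j - x j\<bar> < e; \<And>j. n \<le> j \<Longrightarrow> q j = 0\<rbrakk> \<Longrightarrow> q \<in> S"
    using openin_Euclidean_space_box[OF assms(1,2)] by blast
  have "x j = 0" if "n \<le> j" for j
    using openin_subset[OF assms(1)] assms(2) that by (auto simp: topspace_Euclidean_space)
  then have "x(i := t) \<in> S" if "dist t (x i) < e" for t
    using that e(1) assms(3) by (intro e(2)) (auto simp: dist_real_def)
  then show ?thesis
    using e(1) eventually_nhds_metric by blast
qed

text \<open>The type class topology on functions is the product topology, so continuity can be
  handled through \<open>continuous_on\<close>.\<close>

lemma continuous_map_subtopology_Euclidean_space_iff:
  "continuous_map (subtopology (Euclidean_space n) S) euclideanreal f \<longleftrightarrow>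
   continuous_on (topspace (Euclidean_space n) \<inter> S) f"
  by (simp add: Euclidean_space_def euclidean_product_topology subtopology_subtopology
      flip: continuous_map_iff_continuous)

section \<open>Functions of class \<open>C\<^sup>k\<close>\<close>

lemma Ck_on_imp_continuous_map:
  "Ck_on n k S f \<Longrightarrow> continuous_map (subtopology (Euclidean_space n) S) euclideanreal f"
  by (cases k) auto

lemma Ck_on_Suc_imp: "Ck_on n (Suc k) S f \<Longrightarrow> Ck_on n k S f"
proof (induction k arbitrary: f)
  case (Suc k)
  have "Ck_on n k S (partial_deriv i f)" if "i < n" for i
    \<comment> \<open>A single unfolding leaves the inner \<open>Ck_on\<close> at level
      \<open>Suc k\<close>, the form the induction hypothesis asks for.\<close>
    using Suc.prems that by (intro Suc.IH) (subst (asm) Ck_on.simps, blast)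
  then show ?case
    using Suc.prems by simp
qed simp

text \<open>A partial derivative at a point of \<open>S\<close> sees only a short coordinate
  segment, which lies in \<open>S\<close> because \<open>S\<close> is open. Hence equality on
  \<open>S\<close> passes to partial derivatives, and induction carries it to every order.\<close>

lemma Ck_on_cong:
  assumes "openin (Euclidean_space n) S" and "\<And>x. x \<in> S \<Longrightarrow> f x = g x" and "Ck_on n k S f"
  shows "Ck_on n k S g"
  using assms(2,3)
proof (induction k arbitrary: f g)
  case 0
  then show ?case
    by (auto intro: continuous_map_eq)
next
  case (Suc k)
  have ev: "\<forall>\<^sub>F t in nhds (x i). f (x(i := t)) = g (x(i := t))" if "x \<in> S" "i < n" for x i
    using eventually_fun_upd_in_openin[OF assms(1) that] by eventually_elim (rule Suc.prems)
  have "continuous_map (subtopology (Euclidean_space n) S) euclideanreal g"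
    using Suc.prems by (auto intro: continuous_map_eq)
  moreover have "(\<lambda>t. g (x(i := t))) field_differentiable at (x i)" if "x \<in> S" "i < n" for x i
  proof -
    have "(\<lambda>t. f (x(i := t))) field_differentiable at (x i)"
      using Suc.prems(2) that by simp
    then show ?thesis
      unfolding field_differentiable_def DERIV_cong_ev[OF refl ev[OF that] refl] .
  qed
  moreover have "Ck_on n k S (partial_deriv i g)" if "i < n" for i
  proof (rule Suc.IH)
    show "Ck_on n k S (partial_deriv i f)"
      using Suc.prems(2) that by simp
    show "partial_deriv i f x = partial_deriv i g x" if "x \<in> S" for x
      unfolding partial_deriv_def using ev[OF that \<open>i < n\<close>] by (rule deriv_cong_ev) simp
  qed
  ultimately show ?case
    by simp
qed

text \<open>Continuity and differentiability are tested at points, and one neighbourhood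
  \<open>T\<close> serves \<open>f\<close> and its partial derivatives alike. This lets a coordinate
  expression be studied with a different target chart near each point.\<close>

lemma Ck_on_local:
  assumes "\<And>x. x \<in> S \<Longrightarrow> \<exists>T. openin (Euclidean_space n) T \<and> x \<in> T \<and> Ck_on n k T f"
  shows "Ck_on n k S f"
  using assms
proof (induction k arbitrary: f)
  case 0
  show ?case
    unfolding Ck_on.simps continuous_map_subtopology_Euclidean_space_iff continuous_on_eq_continuous_within
  proof
    fix x assume x: "x \<in> topspace (Euclidean_space n) \<inter> S"
    then obtain T where T: "openin (Euclidean_space n) T" "x \<in> T" "Ck_on n 0 T f"
      using "0.prems" by blast
    obtain V where V: "open V" "T = V \<inter> topspace (Euclidean_space n)"
      using T(1) unfolding Euclidean_space_def
      by (auto simp: openin_subtopology euclidean_product_topology)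
    have "continuous (at x within topspace (Euclidean_space n) \<inter> T) f"
      using T(3) x T(2)
      by (auto simp: continuous_map_subtopology_Euclidean_space_iff continuous_on_eq_continuous_within)
    also have "topspace (Euclidean_space n) \<inter> T = topspace (Euclidean_space n) \<inter> V"
      using V by auto
    \<comment> \<open>As \<open>V\<close> is an open neighbourhood of \<open>x\<close>, continuity
      relative to \<open>T\<close> becomes continuity relative to the whole space, which then
      restricts to \<open>S\<close>.\<close>
    also have "at x within topspace (Euclidean_space n) \<inter> V = at x within topspace (Euclidean_space n)"
      using V T(2) by (intro at_within_nhd[of _ V]) auto
    finally show "continuous (at x within topspace (Euclidean_space n) \<inter> S) f"
      by (rule continuous_within_subset) auto
  qed
next
  case (Suc k)
  have "\<exists>T. openin (Euclidean_space n) T \<and> x \<in> T \<and> Ck_on n k T f" if "x \<in> S" for x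
    using Suc.prems[OF that] Ck_on_Suc_imp by blast
  then have "Ck_on n k S f"
    by (rule Suc.IH)
  then have "continuous_map (subtopology (Euclidean_space n) S) euclideanreal f"
    by (rule Ck_on_imp_continuous_map)
  moreover have "(\<lambda>t. f (x(i := t))) field_differentiable at (x i)" if "x \<in> S" "i < n" for x i
    using Suc.prems[OF that(1)] that(2) by auto
  moreover have "Ck_on n k S (partial_deriv i f)" if "i < n" for i
  proof (rule Suc.IH)
    show "\<exists>T. openin (Euclidean_space n) T \<and> x \<in> T \<and> Ck_on n k T (partial_deriv i f)" if "x \<in> S" for x
      using Suc.prems[OF that] \<open>i < n\<close> by auto
  qed
  ultimately show ?case
    by simp
qed

section \<open>Sums and products of C^k functions\<close>

lemma partial_deriv_const: "partial_deriv i (\<lambda>x. c) = (\<lambda>x. 0)"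
  by (simp add: partial_deriv_def fun_eq_iff)

lemma Ck_on_const: "Ck_on n k S (\<lambda>x. c)"
  by (induction k arbitrary: c) (simp_all add: partial_deriv_const)

lemma Ck_on_add:
  assumes "openin (Euclidean_space n) S" and "Ck_on n k S f" and "Ck_on n k S g"
  shows "Ck_on n k S (\<lambda>x. f x + g x)"
  using assms(2,3)
proof (induction k arbitrary: f g)
  case 0
  then show ?case
    by (auto intro: continuous_map_add)
next
  case (Suc k)
  have "Ck_on n k S (partial_deriv i (\<lambda>x. f x + g x))" if "i < n" for i
  \<comment> \<open>The sum rule for \<open>deriv\<close> applies where both derivatives exist, so
    the two expressions are compared on \<open>S\<close> only.\<close>
  proof (rule Ck_on_cong[OF assms(1)])
    show "Ck_on n k S (\<lambda>x. partial_deriv i f x + partial_deriv i g x)"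
      using Suc.prems that by (intro Suc.IH) auto
    show "partial_deriv i f x + partial_deriv i g x = partial_deriv i (\<lambda>x. f x + g x) x" if "x \<in> S" for x
      using Suc.prems that \<open>i < n\<close> by (simp add: partial_deriv_def)
  qed
  then show ?case
    using Suc.prems by (auto intro: continuous_map_add field_differentiable_add)
qed

text \<open>Induction on \<open>k\<close> by the Leibniz rule. Its terms contain the
  undifferentiated factors too, which enter at level \<open>k\<close> through
  \<open>Ck_on_Suc_imp\<close>.\<close>

lemma Ck_on_mult:
  assumes "openin (Euclidean_space n) S" and "Ck_on n k S f" and "Ck_on n k S g"
  shows "Ck_on n k S (\<lambda>x. f x * g x)"
  using assms(2,3)
proof (induction k arbitrary: f g)
  case 0
  then show ?case
    by (auto intro: continuous_map_real_mult)
next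
  case (Suc k)
  have "Ck_on n k S (partial_deriv i (\<lambda>x. f x * g x))" if "i < n" for i
  proof (rule Ck_on_cong[OF assms(1)])
    show "Ck_on n k S (\<lambda>x. f x * partial_deriv i g x + partial_deriv i f x * g x)"
      using Suc.prems that by (intro Ck_on_add assms(1) Suc.IH) (auto intro: Ck_on_Suc_imp[simplified])
    show "f x * partial_deriv i g x + partial_deriv i f x * g x = partial_deriv i (\<lambda>x. f x * g x) x"
      if "x \<in> S" for x
      using Suc.prems that \<open>i < n\<close> by (simp add: partial_deriv_def)
  qed
  then show ?case
    using Suc.prems by (auto intro: continuous_map_real_mult field_differentiable_mult)
qed

lemma Ck_on_sum:
  assumes "openin (Euclidean_space n) S" and "\<And>j. j \<in> J \<Longrightarrow> Ck_on n k S (f j)"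
  shows "Ck_on n k S (\<lambda>x. \<Sum>j\<in>J. f j x)"
  using assms(2)
proof (induction J rule: infinite_finite_induct)
  case (insert j J)
  have "Ck_on n k S (\<lambda>x. f j x + (\<Sum>j\<in>J. f j x))"
    using insert.prems by (intro Ck_on_add[OF assms(1)] insert.IH) auto
  then show ?case
    using insert.hyps by simp
\<comment> \<open>Over an infinite index set the sum is 0 by convention, hence constant like the
  empty sum.\<close>
qed (simp_all add: Ck_on_const)


section \<open>The chain rule\<close>

text \<open>A coordinate increment may have either sign or vanish, so the mean value theorem is put
  in a form that does not order the endpoints.\<close>

lemma MVT_closed_segment:
  fixes h h' :: "real \<Rightarrow> real"
  assumes "\<And>u. u \<in> closed_segment a b \<Longrightarrow> (h has_real_derivative h' u) (at u)"
  shows "\<exists>u\<in>closed_segment a b. h b - h a = (b - a) * h' u"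
proof -
  consider "a < b" | "b < a" | "a = b"
    by linarith
  then show ?thesis
  proof cases
    case 1
    then obtain u where "a < u" "u < b" "h b - h a = (b - a) * h' u"
      using MVT2[of a b h h'] assms by (auto simp: closed_segment_eq_real_ivl)
    with 1 show ?thesis
      by (intro bexI[of _ u]) (auto simp: closed_segment_eq_real_ivl)
  next
    case 2
    then obtain u where "b < u" "u < a" "h a - h b = (a - b) * h' u"
      using MVT2[of b a h h'] assms by (auto simp: closed_segment_eq_real_ivl)
    with 2 show ?thesis
      by (intro bexI[of _ u]) (auto simp: closed_segment_eq_real_ivl algebra_simps)
  qed simp
qed

text \<open>Convergence in the product topology is coordinatewise.\<close>

lemma tendsto_funI:
  fixes f :: "'a \<Rightarrow> 'b \<Rightarrow> 'c::topological_space"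
  assumes "\<And>i. ((\<lambda>x. f x i) \<longlongrightarrow> l i) F"
  shows "(f \<longlongrightarrow> l) F"
proof -
  have "limitin (product_topology (\<lambda>i. euclidean) UNIV) f l F"
    using assms by (simp add: limitin_componentwise)
  then show ?thesis
    by (simp add: euclidean_product_topology)
qed

text \<open>
  The increment of \<open>G\<close> is telescoped by changing one coordinate at a time, so that each step is
  covered by the one-dimensional mean value theorem.
\<close>

lemma has_real_derivative_compose_C1:
  assumes T: "openin (Euclidean_space m) T"
    and G: "Ck_on m (Suc 0) T G"
    and s: "\<gamma> s \<in> T"
    and ev: "\<forall>\<^sub>F t in at s. \<gamma> t \<in> T"
    and deriv: "\<And>j. j < m \<Longrightarrow> ((\<lambda>t. \<gamma> t j) has_real_derivative d j) (at s)"
  shows "((\<lambda>t. G (\<gamma> t)) has_real_derivative (\<Sum>j<m. partial_deriv j G (\<gamma> s) * d j)) (at s)"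
proof -
  define p where "p = \<gamma> s"
  \<comment> \<open>The hybrid point takes its first \<open>k\<close> coordinates from
    \<open>\<gamma> t\<close> and the others from \<open>p\<close>; passing from \<open>k\<close> to
    \<open>Suc k\<close> changes coordinate \<open>k\<close> alone.\<close>
  define q where "q t k = (\<lambda>j. if j < k then \<gamma> t j else p j)" for t and k :: nat
  have zero: "x j = 0" if "x \<in> T" "m \<le> j" for x j
    using openin_subset[OF T] that by (auto simp: topspace_Euclidean_space)
  have q_upd: "(q t k)(k := p k) = q t k" "(q t k)(k := \<gamma> t k) = q t (Suc k)" for t k
    by (auto simp: q_def fun_eq_iff less_Suc_eq)
  have "p \<in> T"
    using s by (simp add: p_def)
  then obtain e where e: "e > 0"
    "\<And>x. \<lbrakk>\<And>j. j < m \<Longrightarrow> \<bar>x j - p j\<bar> < e; \<And>j. m \<le> j \<Longrightarrow> x j = 0\<rbrakk> \<Longrightarrow> x \<in> T"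
    using openin_Euclidean_space_box[OF T] by blast
  \<comment> \<open>For these \<open>t\<close>, every hybrid point, and every segment between
    consecutive ones, stays in the box of radius \<open>e\<close> around \<open>p\<close> and so in
    \<open>T\<close>.\<close>
  define B where "B = {t. \<gamma> t \<in> T \<and> (\<forall>j<m. \<bar>\<gamma> t j - p j\<bar> < e)}"
  have lim: "((\<lambda>t. \<gamma> t j) \<longlongrightarrow> p j) (at s)" if "j < m" for j
    using DERIV_isCont[OF deriv[OF that]] by (simp add: isCont_def p_def)
  have "\<forall>\<^sub>F t in at s. \<bar>\<gamma> t j - p j\<bar> < e" if "j < m" for j
    using tendstoD[OF lim[OF that] e(1)] by (simp add: dist_real_def)
  then have "\<forall>\<^sub>F t in at s. \<forall>j\<in>{..<m}. \<bar>\<gamma> t j - p j\<bar> < e"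
    by (intro eventually_ball_finite) auto
  with ev have evB: "\<forall>\<^sub>F t in at s. t \<in> B"
    by eventually_elim (auto simp: B_def)
  have seg: "(q t k)(k := u) \<in> T" if "t \<in> B" "k < m" "u \<in> closed_segment (p k) (\<gamma> t k)" for t k u
  proof (rule e(2))
    have u: "\<bar>u - p k\<bar> \<le> \<bar>\<gamma> t k - p k\<bar>"
      using that(3) by (auto simp: closed_segment_eq_real_ivl split: if_splits)
    show "\<bar>((q t k)(k := u)) j - p j\<bar> < e" if "j < m" for j
      using u \<open>t \<in> B\<close> \<open>k < m\<close> \<open>j < m\<close> e(1) by (auto simp: B_def q_def intro: le_less_trans)
    show "((q t k)(k := u)) j = 0" if "m \<le> j" for j
      using that \<open>k < m\<close> zero[OF \<open>p \<in> T\<close>] by (auto simp: q_def)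
  qed
  have "\<exists>u\<in>closed_segment (p k) (\<gamma> t k).
          G (q t (Suc k)) - G (q t k) = (\<gamma> t k - p k) * partial_deriv k G ((q t k)(k := u))"
    if "t \<in> B" "k < m" for t k
  proof -
    have "((\<lambda>u. G ((q t k)(k := u))) has_real_derivative partial_deriv k G ((q t k)(k := u))) (at u)"
      if "u \<in> closed_segment (p k) (\<gamma> t k)" for u
    proof -
      have "(\<lambda>v. G ((q t k)(k := u, k := v))) field_differentiable at (((q t k)(k := u)) k)"
        using G seg[OF \<open>t \<in> B\<close> \<open>k < m\<close> that] \<open>k < m\<close> unfolding Ck_on.simps by blast
      then show ?thesis
        by (simp add: partial_deriv_def DERIV_deriv_iff_field_differentiable)
    qed
    from MVT_closed_segment[of "p k" "\<gamma> t k", OF this] show ?thesis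
      by (simp only: q_upd)
  qed
  then obtain U where U: "\<And>t k. \<lbrakk>t \<in> B; k < m\<rbrakk> \<Longrightarrow> U t k \<in> closed_segment (p k) (\<gamma> t k)"
    "\<And>t k. \<lbrakk>t \<in> B; k < m\<rbrakk> \<Longrightarrow>
       G (q t (Suc k)) - G (q t k) = (\<gamma> t k - p k) * partial_deriv k G ((q t k)(k := U t k))"
    by metis
  have "((\<lambda>t. partial_deriv k G ((q t k)(k := U t k))) \<longlongrightarrow> partial_deriv k G p) (at s)"
    if "k < m" for k
  proof (rule continuous_on_tendsto_compose[where f = "partial_deriv k G"])
    have "continuous_on (topspace (Euclidean_space m) \<inter> T) (partial_deriv k G)"
      using G that by (simp flip: continuous_map_subtopology_Euclidean_space_iff)
    then show "continuous_on T (partial_deriv k G)"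
      using openin_subset[OF T] by (simp add: Int_absorb1)
    show "\<forall>\<^sub>F t in at s. (q t k)(k := U t k) \<in> T"
      using evB by eventually_elim (rule seg[OF _ that U(1)[OF _ that]])
    \<comment> \<open>The intermediate value lies between \<open>p k\<close> and
      \<open>\<gamma> t k\<close>, so it is squeezed to \<open>p k\<close>.\<close>
    have "((\<lambda>t. U t k - p k) \<longlongrightarrow> 0) (at s)"
    proof (rule Lim_null_comparison)
      show "\<forall>\<^sub>F t in at s. norm (U t k - p k) \<le> \<bar>\<gamma> t k - p k\<bar>"
        using evB
      proof eventually_elim
        case (elim t)
        then show ?case
          using U(1)[OF elim that] by (auto simp: closed_segment_eq_real_ivl split: if_splits)
      qed
      show "((\<lambda>t. \<bar>\<gamma> t k - p k\<bar>) \<longlongrightarrow> 0) (at s)"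
        using tendsto_rabs[OF LIM_zero[OF lim[OF that]]] by simp
    qed
    then have "((\<lambda>t. U t k) \<longlongrightarrow> p k) (at s)"
      by (rule LIM_zero_cancel)
    \<comment> \<open>Coordinates below \<open>k\<close> follow \<open>\<gamma> t\<close>,
      coordinate \<open>k\<close> follows \<open>U t k\<close>, and those above are constantly
      \<open>p j\<close>.\<close>
    then have "((\<lambda>t. ((q t k)(k := U t k)) j) \<longlongrightarrow> p j) (at s)" for j
      using that lim[of j] by (cases j k rule: linorder_cases) (simp_all add: q_def)
    then show "((\<lambda>t. (q t k)(k := U t k)) \<longlongrightarrow> p) (at s)"
      by (rule tendsto_funI)
  qed (rule \<open>p \<in> T\<close>)
  moreover have "((\<lambda>t. (\<gamma> t k - p k) / (t - s)) \<longlongrightarrow> d k) (at s)" if "k < m" for k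
    using deriv[OF that] by (simp add: has_field_derivative_iff p_def)
  ultimately have "((\<lambda>t. \<Sum>k<m. partial_deriv k G ((q t k)(k := U t k)) * ((\<gamma> t k - p k) / (t - s)))
      \<longlongrightarrow> (\<Sum>k<m. partial_deriv k G p * d k)) (at s)"
    by (intro tendsto_sum tendsto_mult) auto
  moreover have "\<forall>\<^sub>F t in at s.
      (\<Sum>k<m. partial_deriv k G ((q t k)(k := U t k)) * ((\<gamma> t k - p k) / (t - s))) =
      (G (\<gamma> t) - G (\<gamma> s)) / (t - s)"
    using evB
  proof eventually_elim
    case (elim t)
    \<comment> \<open>Both points vanish from index \<open>m\<close> on, since \<open>p\<close> and
      \<open>\<gamma> t\<close> lie in \<open>T\<close>.\<close>
    have "q t m = \<gamma> t"
      using elim zero[OF \<open>p \<in> T\<close>] zero[of "\<gamma> t"] by (auto simp: q_def B_def fun_eq_iff)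
    moreover have "q t 0 = \<gamma> s"
      by (simp add: q_def p_def)
    ultimately have "G (\<gamma> t) - G (\<gamma> s) = (\<Sum>k<m. G (q t (Suc k)) - G (q t k))"
      using sum_lessThan_telescope[of "\<lambda>k. G (q t k)" m] by simp
    also have "\<dots> = (\<Sum>k<m. (\<gamma> t k - p k) * partial_deriv k G ((q t k)(k := U t k)))"
      using U(2)[OF elim] by simp
    finally show ?case
      by (simp add: sum_divide_distrib mult.commute)
  qed
  ultimately show ?thesis
    unfolding has_field_derivative_iff p_def by (rule Lim_transform_eventually)
qed

section \<open>Composition of C^k functions\<close>

text \<open>Continuity of \<open>\<Phi>\<close> is checked coordinate by coordinate; those from
  \<open>m\<close> on are constantly 0 on \<open>S\<close>, because \<open>\<Phi>\<close> maps
  \<open>S\<close> into \<open>T\<close>.\<close>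

lemma continuous_map_Euclidean_space_compose:
  assumes "openin (Euclidean_space n) S" and "openin (Euclidean_space m) T" and "\<Phi> ` S \<subseteq> T"
    and "\<And>j. j < m \<Longrightarrow> continuous_map (subtopology (Euclidean_space n) S) euclideanreal (\<lambda>y. \<Phi> y j)"
    and "continuous_map (subtopology (Euclidean_space m) T) euclideanreal G"
  shows "continuous_map (subtopology (Euclidean_space n) S) euclideanreal (\<lambda>y. G (\<Phi> y))"
proof -
  have S: "topspace (Euclidean_space n) \<inter> S = S" and T: "topspace (Euclidean_space m) \<inter> T = T"
    using assms(1,2) openin_subset by blast+
  have "continuous_on S (\<lambda>y. \<Phi> y j)" for j
  proof (cases "j < m")
    case True
    then show ?thesis
      using assms(4) by (simp add: continuous_map_subtopology_Euclidean_space_iff S)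
  next
    case False
    have "\<Phi> y \<in> topspace (Euclidean_space m)" if "y \<in> S" for y
      using assms(3) T that by blast
    with False have "\<Phi> y j = 0" if "y \<in> S" for y
      using that by (simp add: topspace_Euclidean_space)
    then show ?thesis
      by (auto intro: continuous_on_eq[OF continuous_on_const])
  qed
  then have "continuous_on S \<Phi>"
    by (rule continuous_on_coordinatewise_then_product)
  then show ?thesis
    using assms(3,5) unfolding continuous_map_subtopology_Euclidean_space_iff S T
    by (intro continuous_on_compose2[of T G S \<Phi>])
qed

text \<open>By the chain rule, a partial derivative of the composite is a sum of products of
  \<open>partial_deriv j G\<close> after \<open>\<Phi>\<close> with partial derivatives of
  \<open>\<Phi>\<close>. The induction is over all \<open>G\<close>, so that it applies to
  \<open>partial_deriv j G\<close>.\<close>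

lemma Ck_on_compose:
  assumes S: "openin (Euclidean_space n) S" and T: "openin (Euclidean_space m) T" and "\<Phi> ` S \<subseteq> T"
    and "\<And>j. j < m \<Longrightarrow> Ck_on n k S (\<lambda>y. \<Phi> y j)"
    and "Ck_on m k T G"
  shows "Ck_on n k S (\<lambda>y. G (\<Phi> y))"
  using assms(4,5)
proof (induction k arbitrary: G)
  case 0
  then show ?case
    using continuous_map_Euclidean_space_compose[OF assms(1-3)] by simp
next
  case (Suc k)
  have chain: "((\<lambda>t. G (\<Phi> (x(i := t)))) has_real_derivative
      (\<Sum>j<m. partial_deriv j G (\<Phi> x) * partial_deriv i (\<lambda>y. \<Phi> y j) x)) (at (x i))"
    if "x \<in> S" "i < n" for x i
  proof -
    \<comment> \<open>The curve is \<open>t \<mapsto> \<Phi> (x(i := t))\<close> with base parameter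
      \<open>x i\<close>; its base point appears as \<open>\<Phi> (x(i := x i))\<close>.\<close>
    have "((\<lambda>t. G (\<Phi> (x(i := t)))) has_real_derivative
      (\<Sum>j<m. partial_deriv j G (\<Phi> (x(i := x i))) * partial_deriv i (\<lambda>y. \<Phi> y j) x)) (at (x i))"
    proof (rule has_real_derivative_compose_C1[OF T])
      show "Ck_on m (Suc 0) T G"
        using Suc.prems(2) by (auto intro: Ck_on_imp_continuous_map)
      show "\<Phi> (x(i := x i)) \<in> T"
        using that assms(3) by auto
      have "\<forall>\<^sub>F t in nhds (x i). \<Phi> (x(i := t)) \<in> T"
        using eventually_fun_upd_in_openin[OF S that] by eventually_elim (use assms(3) in auto)
      then show "\<forall>\<^sub>F t in at (x i). \<Phi> (x(i := t)) \<in> T"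
        by (rule eventually_nhds_conv_at[THEN iffD1, THEN conjunct1])
      show "((\<lambda>t. \<Phi> (x(i := t)) j) has_real_derivative partial_deriv i (\<lambda>y. \<Phi> y j) x) (at (x i))"
        if "j < m" for j
        using Suc.prems(1)[OF that] \<open>x \<in> S\<close> \<open>i < n\<close>
        by (simp add: partial_deriv_def DERIV_deriv_iff_field_differentiable)
    qed
    then show ?thesis
      by simp
  qed
  have "Ck_on n k S (partial_deriv i (\<lambda>y. G (\<Phi> y)))" if "i < n" for i
  proof (rule Ck_on_cong[OF S])
    have "Ck_on n k S (\<lambda>x. partial_deriv j G (\<Phi> x))" if "j < m" for j
    proof (rule Suc.IH)
      show "Ck_on n k S (\<lambda>y. \<Phi> y l)" if "l < m" for l
        using Suc.prems(1)[OF that] by (rule Ck_on_Suc_imp)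
      show "Ck_on m k T (partial_deriv j G)"
        using Suc.prems(2) that by simp
    qed
    then show "Ck_on n k S (\<lambda>x. \<Sum>j<m. partial_deriv j G (\<Phi> x) * partial_deriv i (\<lambda>y. \<Phi> y j) x)"
      using Suc.prems(1) \<open>i < n\<close> by (intro Ck_on_sum Ck_on_mult S) auto
    show "(\<Sum>j<m. partial_deriv j G (\<Phi> x) * partial_deriv i (\<lambda>y. \<Phi> y j) x) =
      partial_deriv i (\<lambda>y. G (\<Phi> y)) x" if "x \<in> S" for x
      using DERIV_imp_deriv[OF chain[OF that \<open>i < n\<close>]] by (simp add: partial_deriv_def)
  qed
  moreover have "continuous_map (subtopology (Euclidean_space n) S) euclideanreal (\<lambda>y. G (\<Phi> y))"
    by (rule continuous_map_Euclidean_space_compose[OF assms(1-3)])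
      (rule Ck_on_imp_continuous_map, erule Suc.prems, rule Ck_on_imp_continuous_map, rule Suc.prems)
  ultimately show ?case
    using chain unfolding Ck_on.simps field_differentiable_def by blast
qed

section \<open>Functoriality of the differential\<close>

text \<open>Near a point, with charts \<open>c\<close> at it and \<open>d\<close> at its image, the
  pullback reads as \<open>g\<close> in the chart \<open>d\<close> composed with
  \<open>\<phi>\<close> in the charts \<open>c\<close> and \<open>d\<close>; both factors are smooth
  by hypothesis.\<close>

lemma restrict0_in_Cinf:
  assumes M: "smooth_manifold M" and N: "smooth_manifold N" and \<phi>: "smooth_map M N \<phi>"
    and g: "g \<in> Cinf N"
  shows "restrict0 (points M) (g \<circ> \<phi>) \<in> Cinf M"
proof -
  have "Ck_on (mdim M) k (c ` (U \<inter> points M)) (\<lambda>y. restrict0 (points M) (g \<circ> \<phi>) (inv_into U c y))"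
    if chart: "(U, c) \<in> atlas M" for U c k
  proof (rule Ck_on_local)
    fix x assume "x \<in> c ` (U \<inter> points M)"
    then obtain u where u: "u \<in> U" "u \<in> points M" "x = c u"
      by auto
    have U: "openin (mtop M) U" "openin (Euclidean_space (mdim M)) (c ` U)"
      and c: "homeomorphic_map (subtopology (mtop M) U) (subtopology (Euclidean_space (mdim M)) (c ` U)) c"
      using M chart by (auto simp: smooth_manifold_def)
    have UM: "U \<subseteq> points M"
      using U(1) by (rule openin_subset)
    then have c_inj: "inj_on c U"
      using homeomorphic_imp_injective_map[OF c] by (simp add: Int_absorb1)
    have \<phi>_cont: "continuous_map (mtop M) (mtop N) \<phi>"
      using \<phi> by (simp add: smooth_map_def)
    then have "\<phi> u \<in> points N"
      using u(2) by (auto simp: continuous_map_def)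
    then obtain V d where V: "(V, d) \<in> atlas N" "\<phi> u \<in> V"
      using N unfolding smooth_manifold_def by blast
    have V_open: "openin (mtop N) V" "openin (Euclidean_space (mdim N)) (d ` V)"
      and d: "homeomorphic_map (subtopology (mtop N) V) (subtopology (Euclidean_space (mdim N)) (d ` V)) d"
      using N V(1) by (auto simp: smooth_manifold_def)
    have VN: "V \<subseteq> points N"
      using V_open(1) by (rule openin_subset)
    then have d_inj: "inj_on d V"
      using homeomorphic_imp_injective_map[OF d] by (simp add: Int_absorb1)
    \<comment> \<open>The part of the source chart that \<open>\<phi>\<close> sends into the target
      chart; its coordinate image is open because \<open>c\<close> is a homeomorphism onto an open
      set.\<close>
    define W where "W = U \<inter> \<phi> -` V"
    have "openin (mtop M) {x \<in> points M. \<phi> x \<in> V}"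
      using \<phi>_cont V_open(1) by (rule openin_continuous_map_preimage)
    then have "openin (mtop M) (U \<inter> {x \<in> points M. \<phi> x \<in> V})"
      using U(1) by (intro openin_Int)
    moreover have "U \<inter> {x \<in> points M. \<phi> x \<in> V} = W"
      using UM by (auto simp: W_def)
    ultimately have "openin (subtopology (mtop M) U) W"
      by (auto simp: openin_subtopology W_def)
    then have W: "openin (Euclidean_space (mdim M)) (c ` W)"
      using homeomorphic_imp_open_map[OF c] U(2) by (auto simp: open_map_def intro: openin_trans_full)
    have "Ck_on (mdim M) k (c ` W) (\<lambda>y. restrict0 (points M) (g \<circ> \<phi>) (inv_into U c y))"
    proof (rule Ck_on_cong[OF W])
      show "Ck_on (mdim M) k (c ` W) (\<lambda>y. g (inv_into V d (d (\<phi> (inv_into U c y)))))"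
      proof (rule Ck_on_compose[OF W V_open(2), where G = "\<lambda>z. g (inv_into V d z)"])
        show "(\<lambda>y. d (\<phi> (inv_into U c y))) ` c ` W \<subseteq> d ` V"
          using c_inj by (auto simp: W_def)
        show "Ck_on (mdim M) k (c ` W) (\<lambda>y. d (\<phi> (inv_into U c y)) j)" if "j < mdim N" for j
          using \<phi> chart V(1) that unfolding smooth_map_def Cinf_on_def W_def by fast
        show "Ck_on (mdim N) k (d ` V) (\<lambda>z. g (inv_into V d z))"
          using g V(1) VN by (auto simp: Cinf_def smooth_on_def Cinf_on_def Int_absorb2)
      qed
      show "g (inv_into V d (d (\<phi> (inv_into U c y)))) = restrict0 (points M) (g \<circ> \<phi>) (inv_into U c y)"
        if "y \<in> c ` W" for y
        using that c_inj d_inj UM by (auto simp: W_def restrict0_def)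
    qed
    moreover have "x \<in> c ` W"
      using u V(2) by (auto simp: W_def)
    ultimately show "\<exists>T. openin (Euclidean_space (mdim M)) T \<and> x \<in> T \<and>
        Ck_on (mdim M) k T (\<lambda>y. restrict0 (points M) (g \<circ> \<phi>) (inv_into U c y))"
      using W by blast
  qed
  then show ?thesis
    by (auto simp: Cinf_def smooth_on_def Cinf_on_def restrict0_def)
qed

lemma smooth_map_in_points: "smooth_map M N \<phi> \<Longrightarrow> x \<in> points M \<Longrightarrow> \<phi> x \<in> points N"
  by (auto simp: smooth_map_def continuous_map_def)

text \<open>For smooth \<open>g\<close> on \<open>M''\<close>, both sides evaluate \<open>v\<close>
  at the pullback of \<open>g\<close> along the composite. The extension by 0 off
  \<open>Cinf M'\<close> does no harm, since the pullback of \<open>g\<close> along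
  \<open>\<psi>\<close> lies in \<open>Cinf M'\<close>.\<close>

lemma differential_compose:
  fixes M :: "'a manifold" and M' :: "'b manifold" and M'' :: "'c manifold"
  assumes "smooth_manifold M'" and "smooth_manifold M''"
    and "smooth_map M M' \<phi>" and "smooth_map M' M'' \<psi>"
  shows "differential M M'' (\<psi> \<circ> \<phi>) v = differential M' M'' \<psi> (differential M M' \<phi> v)"
proof -
  have "restrict0 (points M) (restrict0 (points M') (g \<circ> \<psi>) \<circ> \<phi>) = restrict0 (points M) (g \<circ> (\<psi> \<circ> \<phi>))"
    for g :: "'c \<Rightarrow> real"
    using smooth_map_in_points[OF assms(3)] by (auto simp: restrict0_def fun_eq_iff)
  then show ?thesis
    using restrict0_in_Cinf[OF assms(1,2,4)]
    by (intro ext) (simp add: differential_def restrict0_def[of "Cinf _"])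
qed

lemma differential_add: "differential M N \<phi> (u + v) = differential M N \<phi> u + differential M N \<phi> v"
  by (auto simp: differential_def restrict0_def fun_eq_iff)

lemma differential_zero: "differential M N \<phi> 0 = 0"
  by (auto simp: differential_def restrict0_def fun_eq_iff)

section \<open>The Carnot differential\<close>

text \<open>Fibres are spans of local frames for positive \<open>w\<close>, and zero for
  \<open>w = 0\<close>.\<close>

lemma carnot_manifold_subspace:
  assumes "carnot_manifold r M H" and "p \<in> points M" and "w \<le> r"
  shows "subspace (H w p)"
proof (cases "w = 0")
  case True
  then show ?thesis
    using assms by (simp add: carnot_manifold_def real_vector.subspace_single_0)
next
  case False
  then have "vector_subbundle M (H w)"
    using assms by (simp add: carnot_manifold_def)
  then show ?thesis
    using assms(2) unfolding vector_subbundle_def by (metis subspace_span)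
qed

text \<open>Extends the defining inclusion to \<open>w = 0\<close>, where the fibres are zero; the
  piece of weight 1 is a quotient by that fibre.\<close>

lemma carnot_map_differential:
  assumes "carnot_manifold r M H" and "carnot_manifold r M' H'" and "carnot_map r M H M' H' \<phi>"
    and "x \<in> points M" and "w \<le> r" and "v \<in> H w x"
  shows "differential M M' \<phi> v \<in> H' w (\<phi> x)"
proof (cases "w = 0")
  case True
  have "\<phi> x \<in> points M'"
    using assms(3,4) smooth_map_in_points by (auto simp: carnot_map_def)
  with True show ?thesis
    using assms by (simp add: carnot_manifold_def differential_zero)
next
  case False
  then have "w \<in> {1..r}"
    using assms(5) by simp
  then show ?thesis
    using assms(3,4,6) unfolding carnot_map_def by blast
qed

lemma elt_set_plus_subspace:
  assumes "subspace K" and "h \<in> K"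
  shows "h +o K = K"
proof (intro set_eqI iffI)
  fix x assume "x \<in> K"
  then have "x - h \<in> K"
    using assms by (intro subspace_diff)
  then show "x \<in> h +o K"
    by (rule set_minus_imp_plus)
next
  fix x assume "x \<in> h +o K"
  then obtain b where "b \<in> K" "x = h + b"
    by (auto simp: elt_set_plus_def)
  then show "x \<in> K"
    using assms by (simp add: subspace_add)
qed

text \<open>The induced map is well defined: two representatives differ by some \<open>h\<close> in
  \<open>H (w - 1) a\<close>, whose image is absorbed by \<open>H' (w - 1) (\<phi> a)\<close>. Hence
  \<open>the_elem\<close> is applied to a singleton.\<close>

lemma carnot_differential_piece_coset:
  assumes H: "subspace (H (w - 1) a)" and H': "subspace (H' (w - 1) (\<phi> a))"
    and \<phi>: "\<And>h. h \<in> H (w - 1) a \<Longrightarrow> differential M M' \<phi> h \<in> H' (w - 1) (\<phi> a)"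
  shows "carnot_differential_piece M M' H' \<phi> w a (v +o H (w - 1) a) =
    differential M M' \<phi> v +o H' (w - 1) (\<phi> a)"
proof -
  have "differential M M' \<phi> (v + h) +o H' (w - 1) (\<phi> a) = differential M M' \<phi> v +o H' (w - 1) (\<phi> a)"
    if "h \<in> H (w - 1) a" for h
    using elt_set_plus_subspace[OF H' \<phi>[OF that]]
    by (simp add: differential_add flip: set_plus_rearrange2)
  then have "(\<lambda>h. differential M M' \<phi> (v + h) +o H' (w - 1) (\<phi> a)) ` H (w - 1) a =
      (\<lambda>h. differential M M' \<phi> v +o H' (w - 1) (\<phi> a)) ` H (w - 1) a"
    by (rule image_cong[OF refl])
  also have "\<dots> = {differential M M' \<phi> v +o H' (w - 1) (\<phi> a)}"
    \<comment> \<open>The zero vector makes the index set nonempty, so the constant image is a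
      singleton and not empty.\<close>
    using subspace_0[OF H] by (simp only: image_constant)
  finally have image: "(\<lambda>h. differential M M' \<phi> (v + h) +o H' (w - 1) (\<phi> a)) ` H (w - 1) a =
      {differential M M' \<phi> v +o H' (w - 1) (\<phi> a)}" .
  have "v +o H (w - 1) a = (+) v ` H (w - 1) a"
    by (auto simp: elt_set_plus_def)
  then show ?thesis
    by (simp only: carnot_differential_piece_def image_image image the_elem_eq)
qed

lemma carnot_map_in_points:
  "carnot_map r M H M' H' \<phi> \<Longrightarrow> x \<in> points M \<Longrightarrow> \<phi> x \<in> points M'"
  unfolding carnot_map_def by (elim conjE) (rule smooth_map_in_points)

lemma graded_tangent_coset:
  assumes "\<xi> \<in> graded_tangent r H a" and "w \<in> {1..r}"
  obtains v where "v \<in> H w a" and "\<xi> w = v +o H (w - 1) a"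
proof -
  have "\<xi> w \<in> graded_piece H w a"
    using assms unfolding graded_tangent_def by (rule PiE_mem)
  then show thesis
    unfolding graded_piece_def using that by (elim imageE)
qed

text \<open>The differential of a second map is \<open>undefined\<close> off the graded tangent
  space, so a composite can be evaluated only once the first differential is known to land
  there.\<close>

lemma carnot_differential_in_graded_tangent:
  assumes "carnot_manifold r M H" and "carnot_manifold r M' H'" and "carnot_map r M H M' H' \<phi>"
    and "a \<in> points M" and "\<xi> \<in> graded_tangent r H a"
  shows "carnot_differential r M H M' H' \<phi> a \<xi> \<in> graded_tangent r H' (\<phi> a)"
proof -
  have "carnot_differential_piece M M' H' \<phi> w a (\<xi> w) \<in> graded_piece H' w (\<phi> a)" if w: "w \<in> {1..r}" for w
  proof -
    obtain v where v: "v \<in> H w a" "\<xi> w = v +o H (w - 1) a"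
      using graded_tangent_coset[OF assms(5) w] .
    have "carnot_differential_piece M M' H' \<phi> w a (\<xi> w) = differential M M' \<phi> v +o H' (w - 1) (\<phi> a)"
      unfolding v(2) using w
      by (intro carnot_differential_piece_coset carnot_manifold_subspace[OF assms(1)]
          carnot_manifold_subspace[OF assms(2)] carnot_map_differential[OF assms(1-4)]
          carnot_map_in_points[OF assms(3)] assms(4)) auto
    moreover have "differential M M' \<phi> v \<in> H' w (\<phi> a)"
      using w by (intro carnot_map_differential[OF assms(1-4) _ v(1)]) simp
    ultimately show ?thesis
      by (simp add: graded_piece_def)
  qed
  then show ?thesis
    using assms(5) by (auto simp: carnot_differential_def graded_tangent_def)
qed

theorem proposition5p3:
  fixes M :: "'a manifold" and M' :: "'b manifold" and M'' :: "'c manifold"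
    and H :: "nat \<Rightarrow> 'a \<Rightarrow> 'a tvec set"
    and H' :: "nat \<Rightarrow> 'b \<Rightarrow> 'b tvec set"
    and H'' :: "nat \<Rightarrow> 'c \<Rightarrow> 'c tvec set"
    and \<phi> :: "'a \<Rightarrow> 'b" and \<psi> :: "'b \<Rightarrow> 'c" and r :: nat
  assumes "carnot_manifold r M H"
    and "carnot_manifold r M' H'"
    and "carnot_manifold r M'' H''"
    and "carnot_map r M H M' H' \<phi>"
    and "carnot_map r M' H' M'' H'' \<psi>"
  shows "\<forall>a\<in>points M.
    carnot_differential r M H M'' H'' (\<psi> \<circ> \<phi>) a =
    compose (graded_tangent r H a)
      (carnot_differential r M' H' M'' H'' \<psi> (\<phi> a))
      (carnot_differential r M H M' H' \<phi> a)"
proof (intro ballI ext)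
  fix a \<xi> w
  assume a: "a \<in> points M"
  note a' = carnot_map_in_points[OF assms(4) a]
  note a'' = carnot_map_in_points[OF assms(5) a']
  note sub = carnot_manifold_subspace[OF assms(1) a] carnot_manifold_subspace[OF assms(2) a']
    carnot_manifold_subspace[OF assms(3) a'']
  note maps = carnot_map_differential[OF assms(1,2,4) a]
    carnot_map_differential[OF assms(2,3,5) a']
  have D: "differential M M'' (\<psi> \<circ> \<phi>) v = differential M' M'' \<psi> (differential M M' \<phi> v)" for v
    using assms by (intro differential_compose) (auto simp: carnot_manifold_def carnot_map_def)
  have piece: "carnot_differential_piece M M'' H'' (\<psi> \<circ> \<phi>) w a (\<xi> w) =
      carnot_differential_piece M' M'' H'' \<psi> w (\<phi> a) (carnot_differential_piece M M' H' \<phi> w a (\<xi> w))"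
    if \<xi>: "\<xi> \<in> graded_tangent r H a" and w: "w \<in> {1..r}"
  proof -
    obtain v where v: "\<xi> w = v +o H (w - 1) a"
      using graded_tangent_coset[OF \<xi> w] .
    have le: "w - 1 \<le> r"
      using w by auto
    have "carnot_differential_piece M M' H' \<phi> w a (\<xi> w) = differential M M' \<phi> v +o H' (w - 1) (\<phi> a)"
      unfolding v by (intro carnot_differential_piece_coset sub maps le)
    moreover have "carnot_differential_piece M' M'' H'' \<psi> w (\<phi> a)
        (differential M M' \<phi> v +o H' (w - 1) (\<phi> a)) =
      differential M' M'' \<psi> (differential M M' \<phi> v) +o H'' (w - 1) (\<psi> (\<phi> a))"
      by (intro carnot_differential_piece_coset sub maps le)
    moreover have "carnot_differential_piece M M'' H'' (\<psi> \<circ> \<phi>) w a (\<xi> w) =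
      differential M M'' (\<psi> \<circ> \<phi>) v +o H'' (w - 1) ((\<psi> \<circ> \<phi>) a)"
      \<comment> \<open>By \<open>D\<close>, the inclusion required of the composite reduces to
        those of \<open>\<phi>\<close> and then \<open>\<psi>\<close>.\<close>
      unfolding v by (intro carnot_differential_piece_coset) (simp_all only: D, simp_all only: comp_apply sub le maps)
    ultimately show ?thesis
      by (simp add: D)
  qed
  show "carnot_differential r M H M'' H'' (\<psi> \<circ> \<phi>) a \<xi> w =
    compose (graded_tangent r H a) (carnot_differential r M' H' M'' H'' \<psi> (\<phi> a))
      (carnot_differential r M H M' H' \<phi> a) \<xi> w"
  proof (cases "\<xi> \<in> graded_tangent r H a")
    \<comment> \<open>For \<open>w\<close> outside \<open>{1..r}\<close> both families are
      \<open>undefined\<close>; otherwise \<open>piece\<close> applies.\<close>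
    case True
    then show ?thesis
      using carnot_differential_in_graded_tangent[OF assms(1,2,4) a True] piece
      by (auto simp: compose_def carnot_differential_def)
  next
    \<comment> \<open>Both sides are restricted to \<open>graded_tangent r H a\<close>, hence
      \<open>undefined\<close> here.\<close>
    case False
    then show ?thesis
      by (simp add: compose_def carnot_differential_def)
  qed
qed

end
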